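(* Let $\mu \in \mathbb{R}$ and $b > 0$, let $v \sim \mathrm{Uni}(0,1)$ be drawn from the standard uniform distribution, and transform $v$ through $$G(v) = \mu - b\,\mathrm{sgn}(v)\,\ln\bigl(1 - 2|v|\bigr),$$ where draws $v$ for which the argument $1-2|v|$ of the logarithm is not positive are treated according to either the replacement convention or the rejection convention (both defined in the context). Then, under either convention, the probability distribution of the resulting real-valued sample is not a Laplace distribution.
   Context: For $\mu \in \mathbb{R}$ and $b>0$, the Laplace distribution $\mathrm{Lap}(\mu; b)$ is the probability distribution on $\mathbb{R}$ with density $x \mapsto \frac{1}{2b}\exp(-|x-\mu|/b)$. A probability distribution on $\mathbb{R}$ is called a Laplace distribution if it equals $\mathrm{Lap}(\mu'; b')$ for some $\mu' \in \mathbb{R}$, $b' > 0$. Here $\mathrm{sgn}$ is the sign function and $\ln$ is the real natural logarithm, defined only for positive arguments; hence $G(v)$ is defined for $v \in (0, 1/2)$ and undefined ("NaN") for $v \in [1/2, 1)$. Conventions for undefined values: (i) Replacement convention: one draws $v \sim \mathrm{Uni}(0,1)$ and outputs $G(v)$ if $v < 1/2$, and $0$ if $v \geq 1/2$. (ii) Rejection convention: one draws independent $v \sim \mathrm{Uni}(0,1)$ repeatedly, discarding draws with $v \geq 1/2$, and outputs $G(v)$ for the first draw with $v < 1/2$; that is, the output is distributed as $G(v)$ conditioned on $v < 1/2$. *)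

theory Defs
  imports "HOL-Probability.Probability"
begin

definition laplace_density :: "real \<Rightarrow> real \<Rightarrow> real \<Rightarrow> real" where
  "laplace_density \<mu> b x = 1 / (2 * b) * exp (- \<bar>x - \<mu>\<bar> / b)"

definition laplace_measure :: "real \<Rightarrow> real \<Rightarrow> real measure" where
  "laplace_measure \<mu> b = density lborel (\<lambda>x. ennreal (laplace_density \<mu> b x))"

definition is_laplace_distribution :: "real measure \<Rightarrow> bool" where
  "is_laplace_distribution M \<longleftrightarrow> (\<exists>\<mu>' b'. b' > 0 \<and> M = laplace_measure \<mu>' b')"

definition std_uniform :: "real measure" where
  "std_uniform = uniform_measure lborel {0<..<1}"

(* The transform is meaningful only for 1 - 2 * \<bar>v\<bar> > 0, that is, for v < 1/2 when v is in (0,1).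
   Elsewhere Isabelle's total logarithm returns a value without meaning here; both sampling
   schemes below test v < 1/2 before they apply the transform. *)
definition laplace_transform :: "real \<Rightarrow> real \<Rightarrow> real \<Rightarrow> real" where
  "laplace_transform \<mu> b v = \<mu> - b * sgn v * ln (1 - 2 * \<bar>v\<bar>)"

definition replacement_distribution :: "real \<Rightarrow> real \<Rightarrow> real measure" where
  "replacement_distribution \<mu> b =
     distr std_uniform borel (\<lambda>v. if v < 1 / 2 then laplace_transform \<mu> b v else 0)"

(* The draws form an i.i.d. sequence. LEAST is unspecified on the sequences in which no draw
   is accepted; these form a null set. *)
definition first_accepted :: "real stream \<Rightarrow> real" where
  "first_accepted \<omega> = \<omega> !! (LEAST n. \<omega> !! n < 1 / 2)"

definition rejection_distribution :: "real \<Rightarrow> real \<Rightarrow> real measure" where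
  "rejection_distribution \<mu> b =
     distr (stream_space std_uniform) borel (\<lambda>\<omega>. laplace_transform \<mu> b (first_accepted \<omega>))"

lemma sets_std_uniform [simp, measurable_cong]: "sets std_uniform = sets borel"
  by (simp add: std_uniform_def)

lemma space_std_uniform [simp]: "space std_uniform = UNIV"
  by (simp add: std_uniform_def)

lemma prob_space_std_uniform: "prob_space std_uniform"
  unfolding std_uniform_def by (rule prob_space_uniform_measure) auto

lemma emeasure_std_uniform_less_half: "emeasure std_uniform {v. v < 1 / 2} = ennreal (1 / 2)"
proof -
  have "{0<..<1} \<inter> {v. v < 1 / 2} = {0<..<1 / 2 :: real}"
    by auto
  then show ?thesis
    by (simp add: std_uniform_def divide_ennreal_def)
qed

lemma emeasure_std_uniform_ge_half: "emeasure std_uniform {v. \<not> v < 1 / 2} = ennreal (1 / 2)"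
proof -
  have "{0<..<1} \<inter> {v. \<not> v < 1 / 2} = {1 / 2..<1 :: real}"
    by auto
  then show ?thesis
    by (simp add: std_uniform_def divide_ennreal_def)
qed

lemma borel_measurable_laplace_transform [measurable]:
  "laplace_transform \<mu> b \<in> borel_measurable borel"
  unfolding laplace_transform_def by measurable

lemma measurable_first_accepted [measurable]:
  "first_accepted \<in> borel_measurable (stream_space std_uniform)"
  unfolding first_accepted_def by measurable

lemma first_accepted_accept: "t < 1 / 2 \<Longrightarrow> first_accepted (t ## \<omega>) = t"
  by (simp add: first_accepted_def Least_eq_0)

lemma first_accepted_reject:
  assumes "\<not> t < 1 / 2" "\<exists>n. \<omega> !! n < 1 / 2"
  shows "first_accepted (t ## \<omega>) = first_accepted \<omega>"
proof -
  obtain n where "\<omega> !! n < 1 / 2"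
    using assms(2) by blast
  then have "(LEAST n. (t ## \<omega>) !! n < 1 / 2) = Suc (LEAST n. (t ## \<omega>) !! Suc n < 1 / 2)"
    using assms(1) by (intro Least_Suc[where n = "Suc n"]) auto
  then show ?thesis
    by (simp add: first_accepted_def)
qed

lemma ennreal_half_fixpoint:
  fixes p q :: ennreal
  assumes "p = q + p * ennreal (1 / 2)" "p < \<infinity>" "q < \<infinity>"
  shows "p = q / ennreal (1 / 2)"
proof -
  obtain r s where rs: "p = ennreal r" "0 \<le> r" "q = ennreal s" "0 \<le> s"
    using assms(2,3) by (cases p; cases q) auto
  then have "ennreal r = ennreal (s + r * (1 / 2))"
    using assms(1) by (simp only: ennreal_plus ennreal_mult mult_nonneg_nonneg zero_le_divide_1_iff zero_le_numeral)
  then have "r = s + r * (1 / 2)"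
    using rs by (subst (asm) ennreal_inj) auto
  then have "r = s / (1 / 2)"
    by simp
  then show ?thesis
    using rs by (simp add: divide_ennreal del: ennreal_half)
qed

lemma AE_accepted: "AE \<omega> in stream_space std_uniform. \<exists>n. \<omega> !! n < 1 / 2"
proof -
  interpret U: prob_space std_uniform by (rule prob_space_std_uniform)
  interpret S: prob_space "stream_space std_uniform" by (rule U.prob_space_stream_space)
  let ?S = "stream_space std_uniform"
  let ?N = "{\<omega> \<in> space ?S. \<forall>n. \<not> \<omega> !! n < 1 / 2}"
  have N [measurable]: "?N \<in> sets ?S"
    by measurable
  have "emeasure ?S ?N = (\<integral>\<^sup>+t. emeasure ?S {\<omega> \<in> space ?S. t ## \<omega> \<in> ?N} \<partial>std_uniform)"
    by (rule U.emeasure_stream_space) fact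
  also have "\<dots> = (\<integral>\<^sup>+t. emeasure ?S ?N * indicator {v. \<not> v < 1 / 2} t \<partial>std_uniform)"
  proof (rule nn_integral_cong)
    fix t :: real
    have all_nat_Suc: "(\<forall>n. P n) \<longleftrightarrow> P 0 \<and> (\<forall>n. P (Suc n))" for P :: "nat \<Rightarrow> bool"
      by (metis not0_implies_Suc)
    have "{\<omega> \<in> space ?S. t ## \<omega> \<in> ?N} = (if t < 1 / 2 then {} else ?N)"
      by (subst (1) all_nat_Suc) (auto simp: stream_space_Stream)
    then show "emeasure ?S {\<omega> \<in> space ?S. t ## \<omega> \<in> ?N} =
        emeasure ?S ?N * indicator {v. \<not> v < 1 / 2} t"
      by simp
  qed
  also have "\<dots> = emeasure ?S ?N * ennreal (1 / 2)"
    by (subst nn_integral_cmult_indicator) (simp_all only: emeasure_std_uniform_ge_half, measurable)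
  finally have "emeasure ?S ?N = 0 / ennreal (1 / 2)"
    by (intro ennreal_half_fixpoint) (simp_all add: less_top[symmetric])
  then have "emeasure ?S ?N = 0"
    by simp
  then show ?thesis
    by (intro AE_I[OF _ _ N]) auto
qed

text \<open>The output of the rejection scheme is distributed as the transform of a uniform draw
  conditioned on acceptance.\<close>

lemma rejection_distribution_eq_conditioned:
  "rejection_distribution \<mu> b =
     distr (uniform_measure std_uniform {v. v < 1 / 2}) borel (laplace_transform \<mu> b)"
proof (rule measure_eqI)
  show "sets (rejection_distribution \<mu> b) =
      sets (distr (uniform_measure std_uniform {v. v < 1 / 2}) borel (laplace_transform \<mu> b))"
    by (simp add: rejection_distribution_def)
next
  interpret U: prob_space std_uniform by (rule prob_space_std_uniform)
  interpret S: prob_space "stream_space std_uniform" by (rule U.prob_space_stream_space)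
  let ?S = "stream_space std_uniform"
  fix A assume "A \<in> sets (rejection_distribution \<mu> b)"
  then have A [measurable]: "A \<in> sets borel"
    by (simp add: rejection_distribution_def)
  let ?B = "laplace_transform \<mu> b -` A"
  let ?H = "{v. v < 1 / 2} :: real set"
  let ?E = "{\<omega> \<in> space ?S. first_accepted \<omega> \<in> ?B}"
  have B [measurable]: "?B \<in> sets borel"
    using measurable_sets[OF borel_measurable_laplace_transform A] by simp
  have E [measurable]: "?E \<in> sets ?S"
    by measurable
  have "emeasure ?S ?E = (\<integral>\<^sup>+t. emeasure ?S {\<omega> \<in> space ?S. t ## \<omega> \<in> ?E} \<partial>std_uniform)"
    by (rule U.emeasure_stream_space) fact
  also have "\<dots> = (\<integral>\<^sup>+t. indicator (?H \<inter> ?B) t +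
      emeasure ?S ?E * indicator {v. \<not> v < 1 / 2} t \<partial>std_uniform)"
  proof (rule nn_integral_cong)
    fix t :: real
    show "emeasure ?S {\<omega> \<in> space ?S. t ## \<omega> \<in> ?E} =
        indicator (?H \<inter> ?B) t + emeasure ?S ?E * indicator {v. \<not> v < 1 / 2} t"
    proof (cases "t < 1 / 2")
      case True
      then have "{\<omega> \<in> space ?S. t ## \<omega> \<in> ?E} = (if t \<in> ?B then space ?S else {})"
        by (auto simp: first_accepted_accept stream_space_Stream)
      then show ?thesis
        using True by (simp add: S.emeasure_space_1)
    next
      case False
      have "emeasure ?S {\<omega> \<in> space ?S. t ## \<omega> \<in> ?E} = emeasure ?S ?E"
      proof (rule emeasure_eq_AE)
        show "AE \<omega> in ?S. \<omega> \<in> {\<omega> \<in> space ?S. t ## \<omega> \<in> ?E} \<longleftrightarrow> \<omega> \<in> ?E"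
          using AE_accepted
        proof eventually_elim
          case (elim \<omega>)
          then show ?case
            using first_accepted_reject[OF False elim] by (simp add: stream_space_Stream)
        qed
      qed measurable
      then show ?thesis
        using False by simp
    qed
  qed
  also have "\<dots> = emeasure std_uniform (?H \<inter> ?B) + emeasure ?S ?E * ennreal (1 / 2)"
  proof (subst nn_integral_add)
    show "(\<integral>\<^sup>+t. indicator (?H \<inter> ?B) t \<partial>std_uniform) +
        (\<integral>\<^sup>+t. emeasure ?S ?E * indicator {v. \<not> v < 1 / 2} t \<partial>std_uniform) =
        emeasure std_uniform (?H \<inter> ?B) + emeasure ?S ?E * ennreal (1 / 2)"
      by (subst nn_integral_cmult_indicator, measurable)
         (simp only: emeasure_std_uniform_ge_half, simp)
  qed measurable
  finally have "emeasure ?S ?E = emeasure std_uniform (?H \<inter> ?B) / ennreal (1 / 2)"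
    by (intro ennreal_half_fixpoint) (simp_all add: less_top[symmetric])
  moreover have "emeasure (rejection_distribution \<mu> b) A = emeasure ?S ?E"
    unfolding rejection_distribution_def
    by (subst emeasure_distr) (auto intro!: arg_cong[where f = "emeasure ?S"])
  moreover have "emeasure (distr (uniform_measure std_uniform ?H) borel (laplace_transform \<mu> b)) A =
      emeasure std_uniform (?H \<inter> ?B) / ennreal (1 / 2)"
  proof (subst emeasure_distr)
    have "emeasure (uniform_measure std_uniform ?H) ?B =
        emeasure std_uniform (?H \<inter> ?B) / emeasure std_uniform ?H"
      by (rule emeasure_uniform_measure) measurable
    then show "emeasure (uniform_measure std_uniform ?H)
          (?B \<inter> space (uniform_measure std_uniform ?H)) =
        emeasure std_uniform (?H \<inter> ?B) / ennreal (1 / 2)"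
      unfolding emeasure_std_uniform_less_half by simp
  qed simp_all
  ultimately show "emeasure (rejection_distribution \<mu> b) A =
      emeasure (distr (uniform_measure std_uniform ?H) borel (laplace_transform \<mu> b)) A"
    by simp
qed

end

theory Submission
  imports Defs
begin

text \<open>A Laplace distribution has the same null sets as Lebesgue measure. The replacement convention
  puts mass \<open>1/2\<close> on the point \<open>0\<close>. Under the rejection convention the output is always
  greater than \<open>\<mu>\<close>, because \<open>0 < 1 - 2 * v < 1\<close> for accepted \<open>v\<close>, so the half-line
  below \<open>\<mu>\<close> has mass \<open>0\<close>.\<close>

text \<open>The density is strictly positive at every point, so it integrates to zero over
  \<open>A\<close> only if \<open>A\<close> is Lebesgue-null.\<close>

lemma emeasure_laplace_measure_eq_0_iff:
  assumes b: "b > 0" and A [measurable]: "A \<in> sets borel"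
  shows "emeasure (laplace_measure \<mu> b) A = 0 \<longleftrightarrow> emeasure lborel A = 0"
proof -
  have pos: "\<not> laplace_density \<mu> b x \<le> 0" for x
    using b by (simp add: laplace_density_def not_le)
  have meas [measurable]: "laplace_density \<mu> b \<in> borel_measurable borel"
    unfolding laplace_density_def by measurable
  have "A \<in> null_sets (laplace_measure \<mu> b) \<longleftrightarrow> (AE x in lborel. x \<in> A \<longrightarrow> ennreal (laplace_density \<mu> b x) = 0)"
    unfolding laplace_measure_def by (subst null_sets_density_iff) auto
  also have "\<dots> \<longleftrightarrow> (AE x in lborel. x \<notin> A)"
    using pos by (simp add: ennreal_eq_0_iff)
  also have "\<dots> \<longleftrightarrow> A \<in> null_sets lborel"
    by (subst AE_iff_null_sets) auto
  finally show ?thesis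
    by (simp add: null_sets_def laplace_measure_def)
qed

lemma laplace_transform_gt:
  assumes "b > 0" "0 < v" "v < 1 / 2"
  shows "laplace_transform \<mu> b v > \<mu>"
  using assms by (simp add: laplace_transform_def mult_pos_neg)

text \<open>All rejected draws lie in the preimage of \<open>{0}\<close>. An inclusion suffices;
  equality can fail, since for \<open>\<mu> < 0 < b\<close> some accepted draw is also sent to
  \<open>0\<close>.\<close>

lemma emeasure_replacement_distribution_0:
  "emeasure (replacement_distribution \<mu> b) {0} \<noteq> 0"
proof -
  let ?f = "\<lambda>v. if v < 1 / 2 then laplace_transform \<mu> b v else 0"
  have [measurable]: "?f \<in> borel_measurable borel"
    by measurable
  have "?f \<in> measurable std_uniform borel"
    by measurable
  moreover have "?f -` {0} \<in> sets borel"
    using measurable_sets[of ?f borel borel "{0}"] by simp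
  then have "emeasure std_uniform {v. \<not> v < 1 / 2} \<le> emeasure std_uniform (?f -` {0})"
    by (intro emeasure_mono) auto
  ultimately show ?thesis
    unfolding replacement_distribution_def emeasure_std_uniform_ge_half
    by (auto simp: emeasure_distr)
qed

lemma emeasure_rejection_distribution_lessThan:
  assumes "b > 0"
  shows "emeasure (rejection_distribution \<mu> b) {..<\<mu>} = 0"
proof -
  let ?B = "laplace_transform \<mu> b -` {..<\<mu>}" and ?H = "{v. v < 1 / 2} :: real set"
  have B [measurable]: "?B \<in> sets borel"
    using measurable_sets[OF borel_measurable_laplace_transform, of "{..<\<mu>}"] by simp
  \<comment> \<open>\<open>?H\<close> also contains negative \<open>v\<close>, and those in
    \<open>{-1/2<..<0}\<close> are sent below \<open>\<mu>\<close>; only the support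
    \<open>{0<..<1}\<close> excludes them.\<close>
  have "{0<..<1} \<inter> (?H \<inter> ?B) = {}"
    using laplace_transform_gt[OF assms, of _ \<mu>] by (fastforce dest: less_asym)
  then have "emeasure std_uniform (?H \<inter> ?B) = 0"
    unfolding std_uniform_def by (subst emeasure_uniform_measure) auto
  moreover have "emeasure (uniform_measure std_uniform ?H) ?B =
      emeasure std_uniform (?H \<inter> ?B) / emeasure std_uniform ?H"
    by (rule emeasure_uniform_measure) measurable
  ultimately show ?thesis
    unfolding rejection_distribution_eq_conditioned by (subst emeasure_distr) simp_all
qed

theorem theorem3p1:
  fixes \<mu> b :: real
  assumes "b > 0"
  shows "\<not> is_laplace_distribution (replacement_distribution \<mu> b) \<and>
         \<not> is_laplace_distribution (rejection_distribution \<mu> b)"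
proof
  show "\<not> is_laplace_distribution (replacement_distribution \<mu> b)"
    using emeasure_replacement_distribution_0[of \<mu> b]
    by (auto simp: is_laplace_distribution_def emeasure_laplace_measure_eq_0_iff)
  \<comment> \<open>An interval of length \<open>1\<close> inside the half-line shows that the
    half-line is not Lebesgue-null.\<close>
  have "emeasure lborel {\<mu> - 1<..<\<mu>} \<le> emeasure lborel {..<\<mu>}"
    by (intro emeasure_mono) auto
  then have "emeasure lborel {..<\<mu>} \<noteq> 0"
    by auto
  then show "\<not> is_laplace_distribution (rejection_distribution \<mu> b)"
    using emeasure_rejection_distribution_lessThan[OF assms, of \<mu>]
    by (auto simp: is_laplace_distribution_def emeasure_laplace_measure_eq_0_iff)
qed

end
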